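(* Let $S=(S_k)_{k\in\mathbb{N}_0}$ be a nonnegative martingale on a filtered probability space $(\Omega,\mathcal{F},(\mathcal{F}_k)_{k\in\mathbb{N}_0},\mathbb{P})$, and let $S_\infty$ denote its $\mathbb{P}$-a.s. limit. Then the following are equivalent: (a) $S$ is a bubble. (b) There exist $x\ge 0$ and $k\ge 0$ such that $\lim_{n\to\infty}\mathbb{E}\big[(S_n-S_\infty)\mathbf{1}_{\{x\le S_k\le S_{k+1}\le\dots\le S_n\}}\big]>0$. (c) For all $x\ge 0$ there exists $k\ge 0$ such that $\lim_{n\to\infty}\mathbb{E}\big[(S_n-S_\infty)\mathbf{1}_{\{x\le S_k\le S_{k+1}\le\dots\le S_n\}}\big]>0$.
   Context: A nonnegative martingale $S=(S_k)_{k\in\mathbb{N}_0}$ converges $\mathbb{P}$-a.s. to an integrable random variable $S_\infty$; for a stopping time $\tau$ with values in $\mathbb{N}_0\cup\{\infty\}$, $S_\tau:=S_\infty$ on $\{\tau=\infty\}$. Convention: $\inf\emptyset=\infty$. Definition (bubble): put $\tau_0:=0$ and $\tau_k:=\inf\{j>\tau_{k-1}: S_j<S_{j-1}\}$ for $k\in\mathbb{N}$ (the $k$-th drawdown). The nonnegative martingale $S$ is a bubble (and $\mathbb{P}$ is a bubble measure for $S$) if $\mathbb{E}[S_{\tau_k}]<\mathbb{E}[S_0]$ for some $k\in\mathbb{N}$. *)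

theory Defs
  imports "HOL-Probability.Probability" "HOL-Library.Extended_Nat"
begin

locale filtered_prob_space = prob_space M + filtration "space M" F
  for M :: "'a measure" and F :: "nat \<Rightarrow> 'a measure" +
  assumes sets_F_subset: "\<And>k. sets (F k) \<subseteq> sets M"

definition martingale ::
  "'a measure \<Rightarrow> (nat \<Rightarrow> 'a measure) \<Rightarrow> (nat \<Rightarrow> 'a \<Rightarrow> real) \<Rightarrow> bool" where
  "martingale M F S \<longleftrightarrow>
     filtered_prob_space M F \<and>
     (\<forall>k. S k \<in> borel_measurable (F k)) \<and>
     (\<forall>k. integrable M (S k)) \<and>
     (\<forall>i j. i \<le> j \<longrightarrow> (AE \<omega> in M. real_cond_exp M (F i) (S j) \<omega> = S i \<omega>))"

definition nonneg_martingale ::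
  "'a measure \<Rightarrow> (nat \<Rightarrow> 'a measure) \<Rightarrow> (nat \<Rightarrow> 'a \<Rightarrow> real) \<Rightarrow> bool" where
  "nonneg_martingale M F S \<longleftrightarrow>
     martingale M F S \<and> (\<forall>k. AE \<omega> in M. 0 \<le> S k \<omega>)"

(* A version of the almost sure limit.  For a nonnegative martingale the paths on which
   lim has an unspecified value form a null set, by the martingale convergence theorem. *)
definition limit_value :: "(nat \<Rightarrow> 'a \<Rightarrow> real) \<Rightarrow> 'a \<Rightarrow> real" where
  "limit_value S \<omega> = lim (\<lambda>n. S n \<omega>)"

definition stopped_at :: "(nat \<Rightarrow> 'a \<Rightarrow> real) \<Rightarrow> ('a \<Rightarrow> enat) \<Rightarrow> 'a \<Rightarrow> real" where
  "stopped_at S T \<omega> = (case T \<omega> of enat n \<Rightarrow> S n \<omega> | \<infinity> \<Rightarrow> limit_value S \<omega>)"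

(* The infimum is taken in enat, so it is \<infinity> for the empty set.  Every j considered is
   positive, so the truncated difference j - 1 is the predecessor of j. *)
primrec drawdown_time :: "(nat \<Rightarrow> 'a \<Rightarrow> real) \<Rightarrow> nat \<Rightarrow> 'a \<Rightarrow> enat" where
  "drawdown_time S 0 \<omega> = 0"
| "drawdown_time S (Suc k) \<omega> =
     Inf {enat j | j. drawdown_time S k \<omega> < enat j \<and> S j \<omega> < S (j - 1) \<omega>}"

definition bubble ::
  "'a measure \<Rightarrow> (nat \<Rightarrow> 'a measure) \<Rightarrow> (nat \<Rightarrow> 'a \<Rightarrow> real) \<Rightarrow> bool" where
  "bubble M F S \<longleftrightarrow>
     nonneg_martingale M F S \<and>
     (\<exists>k\<ge>1. (\<integral>\<omega>. stopped_at S (drawdown_time S k) \<omega> \<partial>M) < (\<integral>\<omega>. S 0 \<omega> \<partial>M))"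

(* The event x \<le> S k \<le> S (k+1) \<le> ... \<le> S n; the chain is only meaningful for k \<le> n. *)
definition rising_event ::
  "'a measure \<Rightarrow> (nat \<Rightarrow> 'a \<Rightarrow> real) \<Rightarrow> real \<Rightarrow> nat \<Rightarrow> nat \<Rightarrow> 'a set" where
  "rising_event M S x k n =
     {\<omega> \<in> space M. x \<le> S k \<omega> \<and> (\<forall>i. k \<le> i \<and> i < n \<longrightarrow> S i \<omega> \<le> S (Suc i) \<omega>)}"

end

theory Submission
  imports Defs
begin

text \<open>
  By martingale convergence and dominated convergence the negative part of \<open>S n - S_inf\<close> tends to
  \<open>0\<close> in mean, so the expected loss on any sequence of events may be computed with the positive
  part, which is monotone in the event. Optional sampling shows that \<open>E[S 0] - E[S \<tau>\<^sub>k]\<close> is the limiting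
  loss on the event of fewer than \<open>k\<close> drawdowns up to time \<open>n\<close>. That event contains the rising event
  started at any time \<open>m < k\<close>. Conversely, split it according to the number of drawdowns so far: the part where
  \<open>S n < x\<close> loses nothing by bounded convergence, and a path at a level \<open>S n \<ge> x\<close> has been rising
  since the first time \<open>m\<close> at which it had reached \<open>x\<close> after its last drawdown. The losses on
  these pieces are dominated by summable quantities, so if the loss on every rising event
  vanishes in the limit, then so does their sum.
\<close>

section \<open>Counting drawdowns along a path\<close>

primrec drawdowns :: "(nat \<Rightarrow> 'a \<Rightarrow> real) \<Rightarrow> nat \<Rightarrow> 'a \<Rightarrow> nat" where
  "drawdowns S 0 \<omega> = 0"
| "drawdowns S (Suc n) \<omega> = drawdowns S n \<omega> + (if S (Suc n) \<omega> < S n \<omega> then 1 else 0)"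

lemma drawdowns_mono: "m \<le> n \<Longrightarrow> drawdowns S m \<omega> \<le> drawdowns S n \<omega>"
  by (induction n rule: dec_induct) auto

lemma drawdowns_le: "drawdowns S n \<omega> \<le> n"
  by (induction n) auto

text \<open>Mirrors the recursion of \<open>drawdown_time\<close>: the step from \<open>j\<close> to
  \<open>Suc j\<close> is a drop preceded by at least \<open>k\<close> others.\<close>

lemma Suc_le_drawdowns_iff:
  "Suc k \<le> drawdowns S n \<omega> \<longleftrightarrow> (\<exists>j<n. k \<le> drawdowns S j \<omega> \<and> S (Suc j) \<omega> < S j \<omega>)"
  by (induction n) (auto simp: less_Suc_eq)

text \<open>The count never decreases, so it agrees at \<open>m\<close> and \<open>n\<close> exactly
  when no step in between raises it.\<close>

lemma rising_iff_drawdowns_eq: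
  assumes "m \<le> n"
  shows "(\<forall>i. m \<le> i \<and> i < n \<longrightarrow> S i \<omega> \<le> S (Suc i) \<omega>) \<longleftrightarrow> drawdowns S n \<omega> = drawdowns S m \<omega>"
  using assms
proof (induction n rule: dec_induct)
  case (step n)
  then show ?case
    using drawdowns_mono[of m n S \<omega>] by (auto simp: less_Suc_eq not_less)
qed auto

lemma Inf_enat_le_iff: "Inf A \<le> enat n \<longleftrightarrow> (\<exists>a\<in>A. a \<le> enat n)"
proof
  assume le: "Inf A \<le> enat n"
  then have "A \<noteq> {}" by (auto simp: Inf_enat_def)
  then have "Inf A \<in> A" by (auto simp: Inf_enat_def intro: LeastI)
  with le show "\<exists>a\<in>A. a \<le> enat n" by blast
qed (meson Inf_lower order_trans)

text \<open>Translates drawdown times into counts, which are adapted by their recursion and can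
  serve as positions in a trading strategy.\<close>

lemma drawdown_time_le_iff: "drawdown_time S k \<omega> \<le> enat n \<longleftrightarrow> k \<le> drawdowns S n \<omega>"
proof (induction k arbitrary: n)
  case 0
  show ?case by (simp add: zero_enat_def)
next
  case (Suc k)
  \<comment> \<open>Strictly before \<open>Suc j\<close> means at most \<open>j\<close>, so the
    induction hypothesis covers the strict inequality in the definition.\<close>
  have shift: "drawdown_time S k \<omega> < enat (Suc j) \<longleftrightarrow> k \<le> drawdowns S j \<omega>" for j
    using Suc[of j] by (cases "drawdown_time S k \<omega>") auto
  have "drawdown_time S (Suc k) \<omega> \<le> enat n \<longleftrightarrow>
      (\<exists>j\<le>n. drawdown_time S k \<omega> < enat j \<and> S j \<omega> < S (j - 1) \<omega>)"
    by (auto simp: Inf_enat_le_iff)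
  also have "\<dots> \<longleftrightarrow> (\<exists>j<n. drawdown_time S k \<omega> < enat (Suc j) \<and> S (Suc j) \<omega> < S j \<omega>)"
  proof (intro iffI; elim exE conjE)
    fix j assume "j \<le> n" "drawdown_time S k \<omega> < enat j" "S j \<omega> < S (j - 1) \<omega>"
    \<comment> \<open>The case \<open>j = 0\<close> is excluded because no time lies strictly before
      it.\<close>
    moreover from this obtain i where "j = Suc i" by (cases j) auto
    ultimately show "\<exists>j<n. drawdown_time S k \<omega> < enat (Suc j) \<and> S (Suc j) \<omega> < S j \<omega>"
      by (intro exI[of _ i]) auto
  qed (metis Suc_leI diff_Suc_1)
  finally show ?case by (simp only: shift Suc_le_drawdowns_iff)
qed

section \<open>Almost sure convergence of nonnegative martingales\<close>

text \<open>Doob's strategy: buy one unit at a price of at most \<open>a\<close>, sell it at a price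
  of at least \<open>b\<close>. The value at \<open>n\<close> is the position held over the step
  from \<open>n\<close> to \<open>Suc n\<close>, so it depends on prices up to \<open>n\<close>
  only.\<close>

primrec holding :: "(nat \<Rightarrow> real) \<Rightarrow> real \<Rightarrow> real \<Rightarrow> nat \<Rightarrow> bool" where
  "holding X a b 0 \<longleftrightarrow> X 0 \<le> a"
| "holding X a b (Suc n) \<longleftrightarrow> (if holding X a b n then X (Suc n) < b else X (Suc n) \<le> a)"

primrec upcrossings :: "(nat \<Rightarrow> real) \<Rightarrow> real \<Rightarrow> real \<Rightarrow> nat \<Rightarrow> nat" where
  "upcrossings X a b 0 = 0"
| "upcrossings X a b (Suc n) =
     upcrossings X a b n + (if holding X a b n \<and> b \<le> X (Suc n) then 1 else 0)"

text \<open>A completed trade is bought at \<open>a\<close> or less and sold at \<open>b\<close> or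
  more, so it gains at least \<open>b - a\<close>. For an open position, the present price less
  \<open>a\<close> is a lower bound of its gain so far.\<close>

lemma upcrossings_le_gain:
  "(b - a) * upcrossings X a b n + (if holding X a b n then X n - a else 0)
     \<le> (\<Sum>j<n. (X (Suc j) - X j) * of_bool (holding X a b j))"
  by (induction n) (auto simp: algebra_simps split: if_splits)

lemma mono_upcrossings: "mono (upcrossings X a b)"
  by (rule monoI, rule lift_Suc_mono_le) auto

text \<open>A path that keeps returning below \<open>a\<close> and above \<open>b\<close> always
  buys again and then sells again.\<close>

lemma upcrossings_unbounded:
  assumes low: "\<exists>\<^sub>F n in sequentially. X n < a" and high: "\<exists>\<^sub>F n in sequentially. b < X n"
  shows "\<exists>n. K \<le> upcrossings X a b n"
proof (induction K)
  case (Suc K)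
  then obtain n where n: "K \<le> upcrossings X a b n" by blast
  have "\<exists>n'\<ge>n. holding X a b n'"
  proof (rule ccontr)
    assume no: "\<not> (\<exists>n'\<ge>n. holding X a b n')"
    \<comment> \<open>Starting from \<open>Suc n\<close> keeps the predecessor of \<open>m\<close>
      within the range of \<open>no\<close>: no unit is held there, and the low price at
      \<open>m\<close> triggers a purchase.\<close>
    obtain m where "m \<ge> Suc n" "X m < a"
      using low unfolding frequently_sequentially by blast
    then have "holding X a b m" using no by (cases m) auto
    with no \<open>m \<ge> Suc n\<close> show False by auto
  qed
  then obtain n' where n': "n \<le> n'" "holding X a b n'" by blast
  show ?case
  proof (rule ccontr)
    assume "\<not> ?case"
    then have U: "upcrossings X a b m \<le> K" for m by (auto simp: not_le less_Suc_eq_le)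
    \<comment> \<open>With the count stuck at \<open>K\<close>, the unit held at \<open>n'\<close>
      is never sold; a later price above \<open>b\<close> contradicts this.\<close>
    have hold: "holding X a b m" if "n' \<le> m" for m
      using that
    proof (induction m rule: dec_induct)
      case (step m)
      have "K \<le> upcrossings X a b m"
        using n monoD[OF mono_upcrossings, of n m X a b] n' step(1) by linarith
      with U[of "Suc m"] step.IH show ?case by (auto split: if_splits)
    qed (fact n')
    obtain m where "m \<ge> Suc n'" "b < X m"
      using high unfolding frequently_sequentially by blast
    then show False using hold[of m] hold[of "m - 1"] by (cases m) auto
  qed
qed simp

text \<open>If liminf and limsup differed, two rational levels would fit between them and be crossed
  infinitely often; \<open>low\<close> rules out divergence to infinity. Rational levels keep the
  number of exceptional null sets countable later on.\<close>

lemma convergent_if_no_crossing: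
  fixes X :: "nat \<Rightarrow> real"
  assumes nonneg: "\<And>n. 0 \<le> X n"
    and cross: "\<And>a b. a \<in> \<rat> \<Longrightarrow> b \<in> \<rat> \<Longrightarrow> a < b \<Longrightarrow>
      \<not> ((\<exists>\<^sub>F n in sequentially. X n < a) \<and> (\<exists>\<^sub>F n in sequentially. b < X n))"
    and low: "\<exists>\<^sub>F n in sequentially. X n < K"
  shows "convergent X"
proof -
  let ?l = "liminf (\<lambda>n. ereal (X n))" and ?u = "limsup (\<lambda>n. ereal (X n))"
  obtain q where q: "q \<in> \<rat>" "K < q" using Rats_dense_in_real[of K "K + 1"] by auto
  have "\<exists>\<^sub>F n in sequentially. X n < q"
    using low by (rule frequently_elim1) (use q in auto)
  \<comment> \<open>Crossing from below \<open>q\<close> to above \<open>q + 1\<close> cannot recur,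
    which bounds the limsup.\<close>
  then have "\<not> (\<exists>\<^sub>F n in sequentially. q + 1 < X n)" using cross[of q "q + 1"] q by auto
  then have "?u \<le> ereal (q + 1)"
    by (intro Limsup_bounded) (auto simp: not_frequently not_less)
  have "ereal 0 \<le> ?l" by (intro Liminf_bounded) (auto simp: nonneg)
  have "?u \<le> ?l"
  proof (rule ccontr)
    assume "\<not> ?u \<le> ?l"
    \<comment> \<open>The reals \<open>c < d\<close> separate the extended real liminf and limsup;
      the rationals \<open>a < b\<close> are then taken between them.\<close>
    then obtain c where c: "?l < ereal c" "ereal c < ?u" using ereal_dense2 not_le by metis
    obtain d where d: "ereal c < ereal d" "ereal d < ?u" using c ereal_dense2 by metis
    obtain a where a: "a \<in> \<rat>" "c < a" "a < d" using d Rats_dense_in_real by auto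
    obtain b where b: "b \<in> \<rat>" "a < b" "b < d" using a Rats_dense_in_real by auto
    have "\<exists>\<^sub>F n in sequentially. X n < a"
    proof (rule ccontr)
      assume "\<not> ?thesis"
      then have "ereal a \<le> ?l" by (intro Liminf_bounded) (auto simp: not_frequently not_less)
      with c a show False by (meson ereal_less_eq(3) leD less_imp_le order_trans)
    qed
    moreover have "\<exists>\<^sub>F n in sequentially. b < X n"
    proof (rule ccontr)
      assume "\<not> ?thesis"
      then have "?u \<le> ereal b" by (intro Limsup_bounded) (auto simp: not_frequently not_less)
      with d b show False by (meson ereal_less_eq(3) leD less_imp_le order_trans)
    qed
    ultimately show False using cross[OF a(1) b(1,2)] by blast
  qed
  then have eq: "?l = ?u" by (intro antisym Liminf_le_Limsup) auto
  have "\<exists>r. l = ereal r" if "ereal 0 \<le> l" "l \<le> ereal (q + 1)" for l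
    using that by (cases l) auto
  then obtain r where r: "?l = ereal r"
    using \<open>ereal 0 \<le> ?l\<close> \<open>?u \<le> ereal (q + 1)\<close> eq by metis
  have "(\<lambda>n. ereal (X n)) \<longlonglongrightarrow> ereal r"
    by (rule tendsto_iff_Liminf_eq_Limsup[THEN iffD2]) (use r r[unfolded eq] in auto)
  then show ?thesis by (auto simp: convergent_def)
qed

lemma nonneg_decseq_convergent:
  fixes X :: "nat \<Rightarrow> real"
  assumes "decseq X" "\<And>n. 0 \<le> X n"
  shows "convergent X"
  using decseq_convergent[OF assms(1), of 0] assms(2) unfolding convergent_def by blast

text \<open>Fatou's lemma: the common bound \<open>C\<close> on the means carries over to the
  limit.\<close>

lemma integrable_tendsto_bounded:
  fixes f :: "nat \<Rightarrow> 'a \<Rightarrow> real"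
  assumes int: "\<And>n. integrable M (f n)" and nonneg: "AE \<omega> in M. \<forall>n. 0 \<le> f n \<omega>"
    and bound: "\<And>n. (\<integral>\<omega>. f n \<omega> \<partial>M) \<le> C"
    and lim: "AE \<omega> in M. (\<lambda>n. f n \<omega>) \<longlonglongrightarrow> g \<omega>" and meas: "g \<in> borel_measurable M"
  shows "integrable M g"
proof (rule integrableI_bounded[OF meas])
  have [measurable]: "f n \<in> borel_measurable M" for n
    using int by (rule borel_measurable_integrable)
  have f: "(\<integral>\<^sup>+\<omega>. ennreal (f n \<omega>) \<partial>M) \<le> ennreal C" for n
    using nonneg bound[of n] int
    by (subst nn_integral_eq_integral) (auto elim!: eventually_mono intro: ennreal_leI)
  have "(\<integral>\<^sup>+\<omega>. ennreal (norm (g \<omega>)) \<partial>M) = (\<integral>\<^sup>+\<omega>. liminf (\<lambda>n. ennreal (f n \<omega>)) \<partial>M)"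
  proof (rule nn_integral_cong_AE)
    show "AE \<omega> in M. ennreal (norm (g \<omega>)) = liminf (\<lambda>n. ennreal (f n \<omega>))"
      using nonneg lim
    proof eventually_elim
      case (elim \<omega>)
      have "0 \<le> g \<omega>" using elim by (intro LIMSEQ_le_const) auto
      moreover have "liminf (\<lambda>n. ennreal (f n \<omega>)) = ennreal (g \<omega>)"
        by (intro lim_imp_Liminf tendsto_ennrealI elim) simp
      ultimately show ?case by simp
    qed
  qed
  also have "\<dots> \<le> liminf (\<lambda>n. \<integral>\<^sup>+\<omega>. ennreal (f n \<omega>) \<partial>M)" by (rule nn_integral_liminf) simp
  also have "\<dots> \<le> ennreal C" using f by (intro Liminf_le) (auto intro: always_eventually)
  also have "\<dots> < \<infinity>" by simp
  finally show "(\<integral>\<^sup>+\<omega>. ennreal (norm (g \<omega>)) \<partial>M) < \<infinity>" .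
qed

section \<open>Martingale identities on events and for gains from trading\<close>

locale nonneg_martingale_process =
  fixes M :: "'a measure" and F :: "nat \<Rightarrow> 'a measure" and S :: "nat \<Rightarrow> 'a \<Rightarrow> real"
  assumes nonneg_martingale: "nonneg_martingale M F S"

sublocale nonneg_martingale_process \<subseteq> filtered_prob_space M F
  using nonneg_martingale by (simp add: nonneg_martingale_def martingale_def)

context nonneg_martingale_process
begin

abbreviation S_inf :: "'a \<Rightarrow> real" where "S_inf \<equiv> limit_value S"

lemma subalgebra_F: "subalgebra M (F i)"
  by (simp add: subalgebra_def space_F sets_F_subset)

lemma adapted: "i \<le> n \<Longrightarrow> S i \<in> borel_measurable (F n)"
  using nonneg_martingale sets_F_mono[of i n]
  by (auto simp: nonneg_martingale_def martingale_def space_F intro: measurable_mono[THEN subsetD])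

lemma integrable_S [simp]: "integrable M (S n)"
  using nonneg_martingale by (simp add: nonneg_martingale_def martingale_def)

lemma measurable_S [measurable]: "S n \<in> borel_measurable M"
  using integrable_S by (rule borel_measurable_integrable)

lemma AE_nonneg: "AE \<omega> in M. \<forall>n. 0 \<le> S n \<omega>"
  using nonneg_martingale by (simp add: nonneg_martingale_def AE_all_countable)

lemma measurable_S_inf [measurable]: "S_inf \<in> borel_measurable M"
  unfolding limit_value_def[abs_def] by measurable

text \<open>The martingale property in integrated form, obtained from the defining property of
  conditional expectation; it is used in this form from here on.\<close>

lemma expectation_on_set:
  assumes "A \<in> sets (F i)" "i \<le> j"
  shows "(\<integral>\<omega>. S j \<omega> * indicator A \<omega> \<partial>M) = (\<integral>\<omega>. S i \<omega> * indicator A \<omega> \<partial>M)"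
proof -
  interpret finite_measure_subalgebra M "F i"
    by unfold_locales (rule subalgebra_F)
  have A: "A \<in> sets M" using assms sets_F_subset by auto
  have "(\<integral>\<omega>. S j \<omega> * indicator A \<omega> \<partial>M) = (\<integral>\<omega>\<in>A. S j \<omega> \<partial>M)"
    by (simp add: set_lebesgue_integral_def mult.commute)
  also have "\<dots> = (\<integral>\<omega>\<in>A. real_cond_exp M (F i) (S j) \<omega> \<partial>M)"
    by (rule real_cond_exp_intA) (use assms in auto)
  also have "\<dots> = (\<integral>\<omega>\<in>A. S i \<omega> \<partial>M)"
  proof -
    have "AE \<omega> in M. real_cond_exp M (F i) (S j) \<omega> = S i \<omega>"
      using nonneg_martingale assms unfolding nonneg_martingale_def martingale_def by blast
    then show ?thesis
      using A unfolding set_lebesgue_integral_def by (intro integral_cong_AE) auto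
  qed
  also have "\<dots> = (\<integral>\<omega>. S i \<omega> * indicator A \<omega> \<partial>M)"
    by (simp add: set_lebesgue_integral_def mult.commute)
  finally show ?thesis .
qed

lemma expectation_S: "(\<integral>\<omega>. S n \<omega> \<partial>M) = (\<integral>\<omega>. S 0 \<omega> \<partial>M)"
  using expectation_on_set[of "space M" 0 n] sets.top[of "F 0"]
  by (simp add: space_F cong: Bochner_Integration.integral_cong)

text \<open>Martingale transform: the position \<open>H j\<close> is known at time \<open>j\<close>,
  so by \<open>expectation_on_set\<close> the next increment has mean zero on the event where it is
  held.\<close>

lemma
  assumes "\<And>j. {\<omega>\<in>space M. H j \<omega>} \<in> sets (F j)"
  shows integrable_gain: "integrable M (\<lambda>\<omega>. \<Sum>j<n. (S (Suc j) \<omega> - S j \<omega>) * of_bool (H j \<omega>))"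
    and expectation_gain: "(\<integral>\<omega>. (\<Sum>j<n. (S (Suc j) \<omega> - S j \<omega>) * of_bool (H j \<omega>)) \<partial>M) = 0"
proof -
  have H: "{\<omega>\<in>space M. H j \<omega>} \<in> sets M" for j using assms sets_F_subset by auto
  have eq: "(S (Suc j) \<omega> - S j \<omega>) * of_bool (H j \<omega>) =
     S (Suc j) \<omega> * indicator {\<omega>\<in>space M. H j \<omega>} \<omega> - S j \<omega> * indicator {\<omega>\<in>space M. H j \<omega>} \<omega>"
    if "\<omega> \<in> space M" for j \<omega>
    using that by (auto simp: indicator_def)
  have int: "integrable M (\<lambda>\<omega>. S i \<omega> * indicator {\<omega>\<in>space M. H j \<omega>} \<omega>)" for i j
    using H by (intro integrable_real_mult_indicator) auto
  have int2: "integrable M (\<lambda>\<omega>. (S (Suc j) \<omega> - S j \<omega>) * of_bool (H j \<omega>))" for j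
    using Bochner_Integration.integrable_diff[OF int[of "Suc j" j] int[of j j]]
    by (subst Bochner_Integration.integrable_cong[OF refl eq])
  then show "integrable M (\<lambda>\<omega>. \<Sum>j<n. (S (Suc j) \<omega> - S j \<omega>) * of_bool (H j \<omega>))"
    by (intro Bochner_Integration.integrable_sum)
  have "(\<integral>\<omega>. (S (Suc j) \<omega> - S j \<omega>) * of_bool (H j \<omega>) \<partial>M) = 0" for j
    by (subst Bochner_Integration.integral_cong[OF refl eq])
       (use expectation_on_set[OF assms, of j "Suc j"] int in auto)
  then show "(\<integral>\<omega>. (\<Sum>j<n. (S (Suc j) \<omega> - S j \<omega>) * of_bool (H j \<omega>)) \<partial>M) = 0"
    using int2 by (subst Bochner_Integration.integral_sum) auto
qed

section \<open>Upcrossing inequality and martingale convergence\<close>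

lemma holding_sets: "{\<omega>\<in>space M. holding (\<lambda>i. S i \<omega>) a b n} \<in> sets (F n)"
proof -
  \<comment> \<open>Stated for every later \<open>F m\<close>, because the induction step views the
    earlier position in a larger sigma-algebra.\<close>
  have "Measurable.pred (F m) (\<lambda>\<omega>. holding (\<lambda>i. S i \<omega>) a b n)" if "n \<le> m" for m
    using that
  proof (induction n)
    case 0
    have [measurable]: "S 0 \<in> borel_measurable (F m)" by (rule adapted) simp
    show ?case by simp
  next
    case (Suc n)
    have [measurable]: "S (Suc n) \<in> borel_measurable (F m)" using Suc by (intro adapted)
    have [measurable]: "Measurable.pred (F m) (\<lambda>\<omega>. holding (\<lambda>i. S i \<omega>) a b n)"
      using Suc by simp
    show ?case by simp
  qed
  from this[OF order_refl] show ?thesis by (simp add: pred_def space_F)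
qed

lemma measurable_upcrossings [measurable]:
  "(\<lambda>\<omega>. upcrossings (\<lambda>i. S i \<omega>) a b n) \<in> measurable M (count_space UNIV)"
proof (induction n)
  case (Suc n)
  have [measurable]: "Measurable.pred M (\<lambda>\<omega>. holding (\<lambda>i. S i \<omega>) a b n)"
    using subsetD[OF sets_F_subset holding_sets] by (simp add: pred_def)
  note Suc [measurable]
  show ?case by simp
qed simp

text \<open>Upcrossing inequality: take means in \<open>upcrossings_le_gain\<close>. The gain has
  mean zero, and on a nonnegative path an open position contributes at least \<open>-|a|\<close>.
  The bound does not depend on \<open>n\<close>.\<close>

lemma expectation_upcrossings_le:
  assumes "a < b"
  shows "(\<integral>\<^sup>+\<omega>. upcrossings (\<lambda>i. S i \<omega>) a b n \<partial>M) \<le> ennreal (\<bar>a\<bar> / (b - a))"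
proof -
  let ?U = "\<lambda>\<omega>. real (upcrossings (\<lambda>i. S i \<omega>) a b n)"
  let ?G = "\<lambda>\<omega>. \<Sum>j<n. (S (Suc j) \<omega> - S j \<omega>) * of_bool (holding (\<lambda>i. S i \<omega>) a b j)"
  have le: "AE \<omega> in M. ?U \<omega> \<le> (?G \<omega> + \<bar>a\<bar>) / (b - a)"
    using AE_nonneg
  proof eventually_elim
    case (elim \<omega>)
    have "(b - a) * ?U \<omega> \<le> ?G \<omega> + \<bar>a\<bar>"
      using upcrossings_le_gain[where X = "\<lambda>i. S i \<omega>" and a = a and b = b and n = n] spec[OF elim, of n] by (auto split: if_splits)
    then show ?case using assms by (simp add: field_simps)
  qed
  have int: "integrable M ?G" by (rule integrable_gain[OF holding_sets])
  have "(\<integral>\<^sup>+\<omega>. ?U \<omega> \<partial>M) \<le> (\<integral>\<^sup>+\<omega>. ennreal ((?G \<omega> + \<bar>a\<bar>) / (b - a)) \<partial>M)"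
    using le by (intro nn_integral_mono_AE) (auto elim!: eventually_mono intro: ennreal_leI)
  also have "\<dots> = ennreal (\<integral>\<omega>. (?G \<omega> + \<bar>a\<bar>) / (b - a) \<partial>M)"
  proof (rule nn_integral_eq_integral)
    show "AE \<omega> in M. 0 \<le> (?G \<omega> + \<bar>a\<bar>) / (b - a)"
      using le by eventually_elim (metis of_nat_0_le_iff order_trans)
  qed (use int in auto)
  also have "(\<integral>\<omega>. (?G \<omega> + \<bar>a\<bar>) / (b - a) \<partial>M) = \<bar>a\<bar> / (b - a)"
    using int expectation_gain[OF holding_sets] by (simp add: prob_space)
  finally show ?thesis by (simp add: ennreal_of_nat_eq_real_of_nat)
qed

text \<open>By monotone convergence the uniform bound passes to the total number of upcrossings,
  which is therefore finite almost surely.\<close>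

lemma AE_upcrossings_bounded:
  assumes "a < b"
  shows "AE \<omega> in M. \<exists>K. \<forall>n. upcrossings (\<lambda>i. S i \<omega>) a b n < K"
proof -
  let ?U = "\<lambda>n \<omega>. of_nat (upcrossings (\<lambda>i. S i \<omega>) a b n) :: ennreal"
  have "(\<integral>\<^sup>+\<omega>. (SUP n. ?U n \<omega>) \<partial>M) = (SUP n. \<integral>\<^sup>+\<omega>. ?U n \<omega> \<partial>M)"
    by (rule nn_integral_monotone_convergence_SUP)
       (auto simp: mono_def le_fun_def intro: monoD[OF mono_upcrossings])
  also have "\<dots> \<le> ennreal (\<bar>a\<bar> / (b - a))"
    by (rule SUP_least) (rule expectation_upcrossings_le[OF assms])
  finally have "(\<integral>\<^sup>+\<omega>. (SUP n. ?U n \<omega>) \<partial>M) \<noteq> \<infinity>"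
    by (auto simp: top_unique)
  then have "AE \<omega> in M. (SUP n. ?U n \<omega>) \<noteq> \<infinity>" by (intro nn_integral_PInf_AE) auto
  then show ?thesis
  proof eventually_elim
    case (elim \<omega>)
    then have "(SUP n. ?U n \<omega>) < top" by (simp only: less_top infinity_ennreal_def)
    then obtain K where K: "(SUP n. ?U n \<omega>) < of_nat K"
      using ennreal_Ex_less_of_nat by blast
    have "?U n \<omega> < of_nat K" for n using K SUP_upper[of n UNIV "\<lambda>n. ?U n \<omega>"] by (meson UNIV_I le_less_trans)
    then show ?case by auto
  qed
qed

text \<open>Fatou's lemma with constant means; it keeps almost every path from diverging to
  infinity.\<close>

lemma liminf_nn_integral_S: "(\<integral>\<^sup>+\<omega>. liminf (\<lambda>n. ennreal (S n \<omega>)) \<partial>M) \<le> ennreal (\<integral>\<omega>. S 0 \<omega> \<partial>M)"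
proof -
  have "(\<integral>\<^sup>+\<omega>. ennreal (S n \<omega>) \<partial>M) = ennreal (\<integral>\<omega>. S 0 \<omega> \<partial>M)" for n
    using AE_nonneg expectation_S[of n] by (subst nn_integral_eq_integral) (auto elim!: eventually_mono)
  then show ?thesis
    using nn_integral_liminf[of "\<lambda>n \<omega>. ennreal (S n \<omega>)" M] by (simp add: Liminf_const)
qed

text \<open>Doob's convergence theorem: outside one null set the path is nonnegative, has bounded
  upcrossing counts for all rational levels, and has finite liminf.\<close>

theorem AE_tendsto_S_inf: "AE \<omega> in M. (\<lambda>n. S n \<omega>) \<longlonglongrightarrow> S_inf \<omega>"
proof -
  have "AE \<omega> in M. \<forall>a\<in>\<rat>. \<forall>b\<in>\<rat>. a < b \<longrightarrow> (\<exists>K. \<forall>n. upcrossings (\<lambda>i. S i \<omega>) a b n < K)"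
    using AE_upcrossings_bounded by (simp add: AE_ball_countable countable_rat)
  moreover have "AE \<omega> in M. liminf (\<lambda>n. ennreal (S n \<omega>)) \<noteq> \<infinity>"
    using liminf_nn_integral_S by (intro nn_integral_PInf_AE) (auto simp: top_unique)
  ultimately show ?thesis
    using AE_nonneg
  proof eventually_elim
    case (elim \<omega>)
    obtain K where K: "liminf (\<lambda>n. ennreal (S n \<omega>)) < of_nat K"
      using elim(2) ennreal_Ex_less_of_nat[of "liminf (\<lambda>n. ennreal (S n \<omega>))"] by (auto simp: less_top)
    have "convergent (\<lambda>n. S n \<omega>)"
    proof (rule convergent_if_no_crossing)
      show "\<exists>\<^sub>F n in sequentially. S n \<omega> < real K"
      proof (rule ccontr)
        assume "\<not> ?thesis"
        then have "of_nat K \<le> liminf (\<lambda>n. ennreal (S n \<omega>))"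
          by (intro Liminf_bounded)
             (auto simp: not_frequently not_less ennreal_of_nat_eq_real_of_nat
                intro: ennreal_leI elim!: eventually_mono)
        with K show False by simp
      qed
      fix a b :: real assume "a \<in> \<rat>" "b \<in> \<rat>" "a < b"
      then show "\<not> ((\<exists>\<^sub>F n in sequentially. S n \<omega> < a) \<and> (\<exists>\<^sub>F n in sequentially. b < S n \<omega>))"
        using elim(1) upcrossings_unbounded[of "\<lambda>i. S i \<omega>" a b] by (meson not_le)
    qed (use elim(3) in auto)
    then show ?case by (simp add: limit_value_def convergent_LIMSEQ_iff)
  qed
qed

lemma AE_S_inf_nonneg: "AE \<omega> in M. 0 \<le> S_inf \<omega>"
  using AE_tendsto_S_inf AE_nonneg by eventually_elim (rule LIMSEQ_le_const, auto)

lemma integrable_S_inf [simp]: "integrable M S_inf"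
  by (rule integrable_tendsto_bounded[OF integrable_S AE_nonneg eq_refl[OF expectation_S] AE_tendsto_S_inf])
     simp

section \<open>Excess of the martingale over its limit\<close>

definition excess :: "nat \<Rightarrow> 'a set \<Rightarrow> real" where
  "excess n A = (\<integral>\<omega>. max 0 (S n \<omega> - S_inf \<omega>) * indicator A \<omega> \<partial>M)"

lemma integrable_excess: "A \<in> sets M \<Longrightarrow> integrable M (\<lambda>\<omega>. max 0 (S n \<omega> - S_inf \<omega>) * indicator A \<omega>)"
  by (intro integrable_real_mult_indicator) auto

lemma excess_nonneg: "0 \<le> excess n A"
  unfolding excess_def by (intro Bochner_Integration.integral_nonneg) auto

lemma excess_mono: "A \<subseteq> B \<Longrightarrow> A \<in> sets M \<Longrightarrow> B \<in> sets M \<Longrightarrow> excess n A \<le> excess n B"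
  unfolding excess_def by (intro integral_mono integrable_excess) (auto simp: indicator_def)

lemma excess_UN:
  assumes "finite I" "disjoint_family_on A I" "\<And>i. i \<in> I \<Longrightarrow> A i \<in> sets M"
  shows "excess n (\<Union>i\<in>I. A i) = (\<Sum>i\<in>I. excess n (A i))"
  unfolding excess_def indicator_UN_disjoint[OF assms(1,2)] sum_distrib_left
  by (rule Bochner_Integration.integral_sum) (intro integrable_excess assms)

text \<open>The positive part is at most \<open>S n\<close>, whose mean on an event known at time
  \<open>m\<close> stays constant after \<open>m\<close>. The bound is the same for all
  \<open>n\<close>, as domination requires.\<close>

lemma excess_le:
  assumes "A \<in> sets (F m)" "m \<le> n"
  shows "excess n A \<le> (\<integral>\<omega>. S m \<omega> * indicator A \<omega> \<partial>M)"
proof -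
  have A: "A \<in> sets M" using assms sets_F_subset by auto
  have "excess n A \<le> (\<integral>\<omega>. S n \<omega> * indicator A \<omega> \<partial>M)"
    unfolding excess_def
  proof (intro integral_mono_AE integrable_excess A integrable_real_mult_indicator integrable_S)
    show "AE \<omega> in M. max 0 (S n \<omega> - S_inf \<omega>) * indicator A \<omega> \<le> S n \<omega> * indicator A \<omega>"
      using AE_nonneg AE_S_inf_nonneg by eventually_elim (auto simp: indicator_def)
  qed
  then show ?thesis using expectation_on_set[OF assms] by simp
qed

text \<open>The negative part of \<open>S n - S_inf\<close> is dominated by \<open>S_inf\<close>, so it vanishes in the limit
  on any sequence of events whatsoever.\<close>

lemma loss_tendsto_iff_excess:
  assumes "\<And>n. A n \<in> sets M"
  shows "(\<lambda>n. \<integral>\<omega>. (S n \<omega> - S_inf \<omega>) * indicator (A n) \<omega> \<partial>M) \<longlonglongrightarrow> L \<longleftrightarrow>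
    (\<lambda>n. excess n (A n)) \<longlonglongrightarrow> L"
proof (rule Lim_transform_eq)
  let ?D = "\<lambda>n \<omega>. max 0 (S_inf \<omega> - S n \<omega>)"
  have D: "(\<lambda>n. \<integral>\<omega>. ?D n \<omega> \<partial>M) \<longlonglongrightarrow> (\<integral>\<omega>. 0 \<partial>M)"
  proof (rule integral_dominated_convergence[where w = S_inf])
    show "AE \<omega> in M. (\<lambda>n. ?D n \<omega>) \<longlonglongrightarrow> 0"
      using AE_tendsto_S_inf
    proof eventually_elim
      case (elim \<omega>)
      have "(\<lambda>n. ?D n \<omega>) \<longlonglongrightarrow> max 0 (S_inf \<omega> - S_inf \<omega>)"
        by (intro tendsto_intros elim)
      then show ?case by simp
    qed
    show "AE \<omega> in M. norm (?D n \<omega>) \<le> S_inf \<omega>" for n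
      using AE_nonneg AE_S_inf_nonneg by eventually_elim (auto simp: max_def)
  qed auto
  show "(\<lambda>n. (\<integral>\<omega>. (S n \<omega> - S_inf \<omega>) * indicator (A n) \<omega> \<partial>M) - excess n (A n)) \<longlonglongrightarrow> 0"
  proof (rule Lim_null_comparison[OF always_eventually D[simplified]], rule allI)
    fix n
    have intD: "integrable M (\<lambda>\<omega>. ?D n \<omega> * indicator (A n) \<omega>)"
      by (intro integrable_real_mult_indicator assms) auto
    have "(\<integral>\<omega>. (S n \<omega> - S_inf \<omega>) * indicator (A n) \<omega> \<partial>M) - excess n (A n) =
      (\<integral>\<omega>. (S n \<omega> - S_inf \<omega>) * indicator (A n) \<omega> - max 0 (S n \<omega> - S_inf \<omega>) * indicator (A n) \<omega> \<partial>M)"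
      unfolding excess_def using integrable_excess[OF assms] assms
      by (subst Bochner_Integration.integral_diff) (auto intro!: integrable_real_mult_indicator)
    \<comment> \<open>Loss minus excess is minus the mean of the negative part on
      \<open>A n\<close>; the mean over the whole space bounds it whatever the event.\<close>
    also have "\<dots> = (\<integral>\<omega>. - (?D n \<omega> * indicator (A n) \<omega>) \<partial>M)"
      by (intro Bochner_Integration.integral_cong) (auto simp: max_def indicator_def)
    also have "norm \<dots> = (\<integral>\<omega>. ?D n \<omega> * indicator (A n) \<omega> \<partial>M)"
      by simp
    also have "\<dots> \<le> (\<integral>\<omega>. ?D n \<omega> \<partial>M)"
      by (intro integral_mono intD) (auto simp: indicator_def)
    finally show "norm ((\<integral>\<omega>. (S n \<omega> - S_inf \<omega>) * indicator (A n) \<omega> \<partial>M) - excess n (A n))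
      \<le> (\<integral>\<omega>. ?D n \<omega> \<partial>M)" .
  qed
qed

text \<open>As \<open>S_inf\<close> is nonnegative, the positive part is at most \<open>|x|\<close>
  on \<open>A n\<close>; it tends to zero almost surely, so dominated convergence applies.\<close>

lemma excess_tendsto_0_if_bounded:
  assumes A: "\<And>n. A n \<in> sets M" and bound: "\<And>n \<omega>. \<omega> \<in> A n \<Longrightarrow> S n \<omega> \<le> x"
  shows "(\<lambda>n. excess n (A n)) \<longlonglongrightarrow> 0"
proof -
  let ?f = "\<lambda>n \<omega>. max 0 (S n \<omega> - S_inf \<omega>) * indicator (A n) \<omega>"
  have "(\<lambda>n. \<integral>\<omega>. ?f n \<omega> \<partial>M) \<longlonglongrightarrow> (\<integral>\<omega>. 0 \<partial>M)"
  proof (rule integral_dominated_convergence[where w = "\<lambda>_. \<bar>x\<bar>"])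
    show "AE \<omega> in M. (\<lambda>n. ?f n \<omega>) \<longlonglongrightarrow> 0"
      using AE_tendsto_S_inf
    proof eventually_elim
      case (elim \<omega>)
      have "(\<lambda>n. max 0 (S n \<omega> - S_inf \<omega>)) \<longlonglongrightarrow> max 0 (S_inf \<omega> - S_inf \<omega>)"
        by (intro tendsto_intros elim)
      then have "(\<lambda>n. max 0 (S n \<omega> - S_inf \<omega>)) \<longlonglongrightarrow> 0" by simp
      then show ?case
        by (rule Lim_null_comparison[rotated]) (auto simp: indicator_def)
    qed
    show "AE \<omega> in M. norm (?f n \<omega>) \<le> \<bar>x\<bar>" for n
      using AE_S_inf_nonneg
    proof eventually_elim
      case (elim \<omega>)
      then show ?case using bound[of \<omega> n] by (auto simp: indicator_def max_def)
    qed
    show "?f n \<in> borel_measurable M" for n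
      using integrable_excess[OF A] by (rule borel_measurable_integrable)
  qed auto
  then show ?thesis by (simp add: excess_def)
qed

section \<open>Drawdowns\<close>

lemma drawdowns_sets: "m \<le> n \<Longrightarrow> drawdowns S m \<in> measurable (F n) (count_space UNIV)"
proof (induction m)
  case 0
  show ?case by (simp add: drawdowns.simps(1)[abs_def])
next
  case (Suc m)
  have [measurable]: "S m \<in> borel_measurable (F n)" "S (Suc m) \<in> borel_measurable (F n)"
    using Suc by (auto intro: adapted)
  have [measurable]: "drawdowns S m \<in> measurable (F n) (count_space UNIV)" using Suc by simp
  show ?case unfolding drawdowns.simps(2)[abs_def] by measurable
qed

lemma measurable_drawdowns [measurable]: "drawdowns S n \<in> measurable M (count_space UNIV)"
  using measurable_from_subalg[OF subalgebra_F drawdowns_sets[OF order_refl]] .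

text \<open>The martingale stopped at the \<open>k\<close>-th drawdown, written as a trading gain so
  that \<open>expectation_gain\<close> applies.\<close>

definition stopped_sum :: "nat \<Rightarrow> nat \<Rightarrow> 'a \<Rightarrow> real" where
  "stopped_sum k n \<omega> = S 0 \<omega> + (\<Sum>j<n. (S (Suc j) \<omega> - S j \<omega>) * of_bool (drawdowns S j \<omega> < k))"

text \<open>The increments counted are those starting before the drawdown time, so the sum
  telescopes.\<close>

lemma stopped_sum_eq:
  "stopped_sum k n \<omega> = (case drawdown_time S k \<omega> of enat t \<Rightarrow> S (min n t) \<omega> | \<infinity> \<Rightarrow> S n \<omega>)"
proof (induction n)
  case (Suc n)
  have "stopped_sum k (Suc n) \<omega> =
      stopped_sum k n \<omega> + (S (Suc n) \<omega> - S n \<omega>) * of_bool (drawdowns S n \<omega> < k)"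
    by (simp add: stopped_sum_def)
  moreover have "drawdowns S n \<omega> < k \<longleftrightarrow> \<not> drawdown_time S k \<omega> \<le> enat n"
    by (simp add: drawdown_time_le_iff not_le)
  ultimately show ?case using Suc by (cases "drawdown_time S k \<omega>") (auto simp: min_def)
qed (auto simp: stopped_sum_def split: enat.splits)

lemma integrable_stopped_sum: "integrable M (stopped_sum k n)"
  and expectation_stopped_sum: "(\<integral>\<omega>. stopped_sum k n \<omega> \<partial>M) = (\<integral>\<omega>. S 0 \<omega> \<partial>M)"
proof -
  have H: "{\<omega>\<in>space M. drawdowns S j \<omega> < k} \<in> sets (F j)" for j
  proof -
    note drawdowns_sets[OF order_refl, of j, measurable]
    have "{\<omega>\<in>space (F j). drawdowns S j \<omega> < k} \<in> sets (F j)" by measurable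
    then show ?thesis by (simp add: space_F)
  qed
  show "integrable M (stopped_sum k n)"
    unfolding stopped_sum_def[abs_def]
    by (intro Bochner_Integration.integrable_add integrable_S integrable_gain H)
  show "(\<integral>\<omega>. stopped_sum k n \<omega> \<partial>M) = (\<integral>\<omega>. S 0 \<omega> \<partial>M)"
    unfolding stopped_sum_def using integrable_gain[OF H] expectation_gain[OF H]
    by (subst Bochner_Integration.integral_add) auto
qed

text \<open>The sums are eventually constant if the drawdown time is finite and equal the path
  itself otherwise. The disjunction admits every path of the first kind, convergent or not.\<close>

lemma stopped_sum_tendsto:
  assumes "(\<lambda>n. S n \<omega>) \<longlonglongrightarrow> S_inf \<omega> \<or> drawdown_time S k \<omega> \<noteq> \<infinity>"
  shows "(\<lambda>n. stopped_sum k n \<omega>) \<longlonglongrightarrow> stopped_at S (drawdown_time S k) \<omega>"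
proof (cases "drawdown_time S k \<omega>")
  case (enat t)
  then have "\<forall>\<^sub>F n in sequentially. stopped_sum k n \<omega> = S t \<omega>"
    by (auto simp: stopped_sum_eq eventually_sequentially min_def intro!: exI[of _ t])
  then show ?thesis
    by (subst tendsto_cong) (auto simp: stopped_at_def enat)
qed (use assms in \<open>simp add: stopped_at_def stopped_sum_eq\<close>)

text \<open>Holds on every path: if the \<open>k\<close>-th drawdown never comes, both sides are
  \<open>lim\<close> of the same sequence. This gives measurability of the stopped value.\<close>

lemma stopped_at_eq_lim: "stopped_at S (drawdown_time S k) \<omega> = lim (\<lambda>n. stopped_sum k n \<omega>)"
proof (cases "drawdown_time S k \<omega>")
  case (enat t)
  then show ?thesis by (intro limI[symmetric] stopped_sum_tendsto) auto
qed (simp add: stopped_at_def stopped_sum_eq limit_value_def)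

lemma integrable_stopped_at: "integrable M (stopped_at S (drawdown_time S k))"
proof (rule integrable_tendsto_bounded[OF integrable_stopped_sum _ eq_refl[OF expectation_stopped_sum]])
  show "AE \<omega> in M. \<forall>n. 0 \<le> stopped_sum k n \<omega>"
    using AE_nonneg by eventually_elim (auto simp: stopped_sum_eq split: enat.splits)
  show "AE \<omega> in M. (\<lambda>n. stopped_sum k n \<omega>) \<longlonglongrightarrow> stopped_at S (drawdown_time S k) \<omega>"
    using AE_tendsto_S_inf by eventually_elim (auto intro: stopped_sum_tendsto)
  have [measurable]: "stopped_sum k n \<in> borel_measurable M" for n
    using integrable_stopped_sum by (rule borel_measurable_integrable)
  show "stopped_at S (drawdown_time S k) \<in> borel_measurable M"
    unfolding stopped_at_eq_lim[abs_def] by measurable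
qed

text \<open>Stopping keeps the mean at that of \<open>S 0\<close>. The stopped sum differs from its
  limit only on the event of fewer than \<open>k\<close> drawdowns, where the difference is
  \<open>S n - S_inf\<close> plus a remainder that vanishes in mean.\<close>

lemma loss_drawdown_time:
  "(\<lambda>n. \<integral>\<omega>. (S n \<omega> - S_inf \<omega>) * indicator {\<omega>\<in>space M. drawdowns S n \<omega> < k} \<omega> \<partial>M)
     \<longlonglongrightarrow> (\<integral>\<omega>. S 0 \<omega> \<partial>M) - (\<integral>\<omega>. stopped_at S (drawdown_time S k) \<omega> \<partial>M)"
proof -
  let ?Y = "stopped_at S (drawdown_time S k)"
  let ?A = "\<lambda>n. {\<omega>\<in>space M. drawdowns S n \<omega> < k}"
  \<comment> \<open>Nonzero only on paths whose \<open>k\<close>-th drawdown is finite but still to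
    come after \<open>n\<close>.\<close>
  let ?r = "\<lambda>n \<omega>. (S_inf \<omega> - ?Y \<omega>) * indicator (?A n) \<omega>"
  note Y = integrable_stopped_at[of k]
  have [measurable]: "?Y \<in> borel_measurable M" using Y by (rule borel_measurable_integrable)
  have int: "integrable M (\<lambda>\<omega>. (S n \<omega> - S_inf \<omega>) * indicator (?A n) \<omega>)" "integrable M (?r n)" for n
    using Y by (auto intro!: integrable_real_mult_indicator)
  have eq: "stopped_sum k n \<omega> - ?Y \<omega> = (S n \<omega> - S_inf \<omega>) * indicator (?A n) \<omega> + ?r n \<omega>"
    if "\<omega> \<in> space M" for n \<omega>
    using that drawdown_time_le_iff[of S k \<omega> n]
    by (auto simp: stopped_sum_eq stopped_at_def indicator_def not_le min_def split: enat.splits)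
  have "(\<integral>\<omega>. S 0 \<omega> \<partial>M) - (\<integral>\<omega>. ?Y \<omega> \<partial>M) = (\<integral>\<omega>. stopped_sum k n \<omega> - ?Y \<omega> \<partial>M)" for n
    using Y integrable_stopped_sum expectation_stopped_sum by simp
  also have "\<dots> n = (\<integral>\<omega>. (S n \<omega> - S_inf \<omega>) * indicator (?A n) \<omega> \<partial>M) + (\<integral>\<omega>. ?r n \<omega> \<partial>M)" for n
    by (subst Bochner_Integration.integral_cong[OF refl eq])
       (auto intro: Bochner_Integration.integral_add int)
  finally have split: "(\<integral>\<omega>. (S n \<omega> - S_inf \<omega>) * indicator (?A n) \<omega> \<partial>M) =
      (\<integral>\<omega>. S 0 \<omega> \<partial>M) - (\<integral>\<omega>. ?Y \<omega> \<partial>M) - (\<integral>\<omega>. ?r n \<omega> \<partial>M)" for n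
    by (simp add: algebra_simps)
  have "(\<lambda>n. \<integral>\<omega>. ?r n \<omega> \<partial>M) \<longlonglongrightarrow> (\<integral>\<omega>. 0 \<partial>M)"
  proof (rule integral_dominated_convergence[where w = "\<lambda>\<omega>. \<bar>S_inf \<omega>\<bar> + \<bar>?Y \<omega>\<bar>"])
    show "AE \<omega> in M. (\<lambda>n. ?r n \<omega>) \<longlonglongrightarrow> 0"
    proof (rule AE_I2)
      fix \<omega>
      show "(\<lambda>n. ?r n \<omega>) \<longlonglongrightarrow> 0"
      proof (cases "drawdown_time S k \<omega>")
        case (enat t)
        then have "\<forall>\<^sub>F n in sequentially. ?r n \<omega> = 0"
          using drawdown_time_le_iff[of S k \<omega>]
          by (auto simp: eventually_sequentially indicator_def intro!: exI[of _ t])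
        then show ?thesis by (rule tendsto_eventually)
      qed (simp add: stopped_at_def)
    qed
    show "AE \<omega> in M. norm (?r n \<omega>) \<le> \<bar>S_inf \<omega>\<bar> + \<bar>?Y \<omega>\<bar>" for n
      by (auto simp: indicator_def)
    show "integrable M (\<lambda>\<omega>. \<bar>S_inf \<omega>\<bar> + \<bar>?Y \<omega>\<bar>)" using Y by simp
    show "?r n \<in> borel_measurable M" for n using int by (intro borel_measurable_integrable)
  qed auto
  then show ?thesis
    unfolding split by (auto intro: tendsto_eq_intros)
qed

lemma excess_drawdowns_tendsto:
  "(\<lambda>n. excess n {\<omega>\<in>space M. drawdowns S n \<omega> < k})
     \<longlonglongrightarrow> (\<integral>\<omega>. S 0 \<omega> \<partial>M) - (\<integral>\<omega>. stopped_at S (drawdown_time S k) \<omega> \<partial>M)"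
  using loss_drawdown_time by (subst loss_tendsto_iff_excess[symmetric]) auto

section \<open>Rising events\<close>

lemma rising_event_eq:
  "m \<le> n \<Longrightarrow> rising_event M S x m n =
     {\<omega>\<in>space M. x \<le> S m \<omega> \<and> drawdowns S n \<omega> = drawdowns S m \<omega>}"
  using rising_iff_drawdowns_eq[of m n S] by (auto simp: rising_event_def)

lemma rising_event_sets: "m \<le> n \<Longrightarrow> rising_event M S x m n \<in> sets (F n)"
proof -
  assume "m \<le> n"
  note [measurable del] = measurable_S measurable_drawdowns
  have [measurable]: "S m \<in> borel_measurable (F n)"
    using \<open>m \<le> n\<close> by (rule adapted)
  have [measurable]: "(\<lambda>\<omega>. real (drawdowns S j \<omega>)) \<in> borel_measurable (F n)" if "j \<le> n" for j
    using drawdowns_sets[OF that] by (rule measurable_compose) simp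
  have "{\<omega>\<in>space (F n). x \<le> S m \<omega> \<and> real (drawdowns S n \<omega>) = real (drawdowns S m \<omega>)} \<in> sets (F n)"
    using \<open>m \<le> n\<close> by measurable
  then show ?thesis by (simp add: rising_event_eq[OF \<open>m \<le> n\<close>] space_F)
qed

lemma rising_event_measurable [measurable]: "rising_event M S x m n \<in> sets M"
  unfolding rising_event_def by measurable

text \<open>Rising events shrink as \<open>n\<close> grows, so the mean of \<open>S_inf\<close> on
  them decreases, and from time \<open>m\<close> on so does that of \<open>S n\<close>, by the
  martingale property. Hence their difference, the loss, converges, and the excess with it.\<close>

lemma excess_rising_event_convergent: "convergent (\<lambda>n. excess n (rising_event M S x m n))"
proof -
  let ?R = "\<lambda>n. rising_event M S x m n"
  have sub: "?R n' \<subseteq> ?R n" if "n \<le> n'" for n n'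
    using that by (auto simp: rising_event_def)
  have int: "integrable M (\<lambda>\<omega>. S j \<omega> * indicator (?R n) \<omega>)"
    "integrable M (\<lambda>\<omega>. S_inf \<omega> * indicator (?R n) \<omega>)" for j n
    by (auto intro!: integrable_real_mult_indicator)
  \<comment> \<open>Shifted by \<open>m\<close>: for \<open>n < m\<close> the event still involves
    \<open>S m\<close> and may be unknown at time \<open>n\<close>.\<close>
  have "convergent (\<lambda>n. \<integral>\<omega>. S (n + m) \<omega> * indicator (?R (n + m)) \<omega> \<partial>M)"
  proof (rule nonneg_decseq_convergent)
    show "decseq (\<lambda>n. \<integral>\<omega>. S (n + m) \<omega> * indicator (?R (n + m)) \<omega> \<partial>M)"
    proof (rule decseq_SucI)
      fix n
      have "(\<integral>\<omega>. S (Suc n + m) \<omega> * indicator (?R (Suc n + m)) \<omega> \<partial>M)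
        \<le> (\<integral>\<omega>. S (Suc n + m) \<omega> * indicator (?R (n + m)) \<omega> \<partial>M)"
      proof (intro integral_mono_AE int)
        show "AE \<omega> in M. S (Suc n + m) \<omega> * indicator (?R (Suc n + m)) \<omega>
          \<le> S (Suc n + m) \<omega> * indicator (?R (n + m)) \<omega>"
          using AE_nonneg
          by eventually_elim (use sub[of "n + m" "Suc n + m"] in \<open>auto simp: indicator_def\<close>)
      qed
      also have "\<dots> = (\<integral>\<omega>. S (n + m) \<omega> * indicator (?R (n + m)) \<omega> \<partial>M)"
        by (rule expectation_on_set[OF rising_event_sets]) auto
      finally show "(\<integral>\<omega>. S (Suc n + m) \<omega> * indicator (?R (Suc n + m)) \<omega> \<partial>M)
        \<le> (\<integral>\<omega>. S (n + m) \<omega> * indicator (?R (n + m)) \<omega> \<partial>M)" .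
    qed
    show "0 \<le> (\<integral>\<omega>. S (n + m) \<omega> * indicator (?R (n + m)) \<omega> \<partial>M)" for n
      using AE_nonneg by (intro integral_nonneg_AE) (auto elim!: eventually_mono)
  qed
  then have 1: "convergent (\<lambda>n. \<integral>\<omega>. S n \<omega> * indicator (?R n) \<omega> \<partial>M)"
    by (rule convergent_ignore_initial_segment
          [of "\<lambda>n. \<integral>\<omega>. S n \<omega> * indicator (?R n) \<omega> \<partial>M", THEN iffD1])
  have 2: "convergent (\<lambda>n. \<integral>\<omega>. S_inf \<omega> * indicator (?R n) \<omega> \<partial>M)"
  proof (rule nonneg_decseq_convergent)
    show "decseq (\<lambda>n. \<integral>\<omega>. S_inf \<omega> * indicator (?R n) \<omega> \<partial>M)"
    proof (intro decseq_SucI integral_mono_AE int)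
      fix n
      show "AE \<omega> in M. S_inf \<omega> * indicator (?R (Suc n)) \<omega> \<le> S_inf \<omega> * indicator (?R n) \<omega>"
        using AE_S_inf_nonneg
        by eventually_elim (use sub[of n "Suc n"] in \<open>auto simp: indicator_def\<close>)
    qed
    show "0 \<le> (\<integral>\<omega>. S_inf \<omega> * indicator (?R n) \<omega> \<partial>M)" for n
      using AE_S_inf_nonneg by (intro integral_nonneg_AE) (auto elim!: eventually_mono)
  qed
  have "(\<integral>\<omega>. (S n \<omega> - S_inf \<omega>) * indicator (?R n) \<omega> \<partial>M) =
      (\<integral>\<omega>. S n \<omega> * indicator (?R n) \<omega> \<partial>M) - (\<integral>\<omega>. S_inf \<omega> * indicator (?R n) \<omega> \<partial>M)" for n
    unfolding left_diff_distrib by (rule Bochner_Integration.integral_diff[OF int])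
  then have "convergent (\<lambda>n. \<integral>\<omega>. (S n \<omega> - S_inf \<omega>) * indicator (?R n) \<omega> \<partial>M)"
    using convergent_diff[OF 1 2] by simp
  then show ?thesis
    using loss_tendsto_iff_excess[of ?R] by (auto simp: convergent_def)
qed

text \<open>The hitting time of level \<open>x\<close> by the rising stretch after \<open>i\<close>
  drawdowns equals \<open>m\<close>. Each event is known at time \<open>m\<close>, and distinct
  \<open>m\<close> give disjoint events.\<close>

definition entry_event :: "nat \<Rightarrow> real \<Rightarrow> nat \<Rightarrow> 'a set" where
  "entry_event i x m = {\<omega>\<in>space M. drawdowns S m \<omega> = i \<and> x \<le> S m \<omega> \<and>
     (\<forall>j<m. drawdowns S j \<omega> = i \<longrightarrow> S j \<omega> < x)}"

lemma entry_event_sets: "entry_event i x m \<in> sets (F m)"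
proof -
  note [measurable del] = measurable_S measurable_drawdowns
  have reached: "Measurable.pred (F m) (\<lambda>\<omega>. drawdowns S j \<omega> = i \<and> x \<le> S j \<omega>)"
    and below: "Measurable.pred (F m) (\<lambda>\<omega>. drawdowns S j \<omega> = i \<longrightarrow> S j \<omega> < x)" if "j \<le> m" for j
  proof -
    have [measurable]: "S j \<in> borel_measurable (F m)"
      "drawdowns S j \<in> measurable (F m) (count_space UNIV)"
      using that by (auto intro: adapted drawdowns_sets)
    show "Measurable.pred (F m) (\<lambda>\<omega>. drawdowns S j \<omega> = i \<and> x \<le> S j \<omega>)"
      and "Measurable.pred (F m) (\<lambda>\<omega>. drawdowns S j \<omega> = i \<longrightarrow> S j \<omega> < x)"
      by measurable
  qed
  have "Measurable.pred (F m) (\<lambda>\<omega>. (drawdowns S m \<omega> = i \<and> x \<le> S m \<omega>) \<and>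
      (\<forall>j\<in>{..<m}. drawdowns S j \<omega> = i \<longrightarrow> S j \<omega> < x))"
    by (rule pred_intros_logic(3)[OF reached pred_intros_finite(3)[OF _ below]]) auto
  then show ?thesis by (simp add: entry_event_def pred_def space_F Ball_def conj_assoc)
qed

lemma disjoint_entry_event: "disjoint_family_on (entry_event i x) I"
  unfolding disjoint_family_on_def entry_event_def
  by (auto, metis linorder_neqE_nat not_le)

text \<open>Moving the terms to a common time \<open>n\<close> by the martingale property and using
  disjointness bounds each partial sum by the mean of \<open>S n\<close>, hence of
  \<open>S 0\<close>.\<close>

lemma summable_entry_event: "summable (\<lambda>m. \<integral>\<omega>. S m \<omega> * indicator (entry_event i x m) \<omega> \<partial>M)"
proof (rule summableI_nonneg_bounded)
  let ?G = "entry_event i x"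
  have G: "?G m \<in> sets M" for m using entry_event_sets sets_F_subset by blast
  show "0 \<le> (\<integral>\<omega>. S m \<omega> * indicator (?G m) \<omega> \<partial>M)" for m
    using AE_nonneg by (intro integral_nonneg_AE) (auto elim!: eventually_mono)
  fix n
  have "(\<Sum>m<n. \<integral>\<omega>. S m \<omega> * indicator (?G m) \<omega> \<partial>M) = (\<Sum>m<n. \<integral>\<omega>. S n \<omega> * indicator (?G m) \<omega> \<partial>M)"
    by (intro sum.cong refl expectation_on_set[symmetric] entry_event_sets) auto
  also have "\<dots> = (\<integral>\<omega>. S n \<omega> * indicator (\<Union>m<n. ?G m) \<omega> \<partial>M)"
    unfolding indicator_UN_disjoint[OF finite_lessThan disjoint_entry_event] sum_distrib_left
    by (rule Bochner_Integration.integral_sum[symmetric]) (intro integrable_real_mult_indicator G integrable_S)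
  also have "\<dots> \<le> (\<integral>\<omega>. S n \<omega> \<partial>M)"
  proof (intro integral_mono_AE integrable_real_mult_indicator sets.finite_UN G integrable_S)
    show "AE \<omega> in M. S n \<omega> * indicator (\<Union>m<n. ?G m) \<omega> \<le> S n \<omega>"
      using AE_nonneg by eventually_elim (simp add: indicator_def)
  qed simp
  finally show "(\<Sum>m<n. \<integral>\<omega>. S m \<omega> * indicator (?G m) \<omega> \<partial>M) \<le> (\<integral>\<omega>. S 0 \<omega> \<partial>M)"
    by (simp only: expectation_S[of n])
qed

text \<open>Take for \<open>m\<close> the hitting time: the count is \<open>i\<close> at both
  \<open>m\<close> and \<open>n\<close>, so the path rises in between. Conversely, rising keeps it
  at or above \<open>x\<close>.\<close>

lemma entry_decomposition:
  "{\<omega>\<in>space M. drawdowns S n \<omega> = i \<and> x \<le> S n \<omega>} =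
     (\<Union>m\<le>n. entry_event i x m \<inter> rising_event M S x m n)" (is "?L = ?R")
proof (intro equalityI subsetI)
  fix \<omega> assume w: "\<omega> \<in> ?L"
  let ?P = "\<lambda>m. drawdowns S m \<omega> = i \<and> x \<le> S m \<omega>"
  define m where "m = (LEAST m. ?P m)"
  have P: "?P m" unfolding m_def by (rule LeastI[of ?P n]) (use w in auto)
  have "m \<le> n" unfolding m_def by (rule Least_le) (use w in auto)
  have "S j \<omega> < x" if "j < m" "drawdowns S j \<omega> = i" for j
    using not_less_Least[of j ?P] that unfolding m_def by auto
  with P w \<open>m \<le> n\<close> show "\<omega> \<in> ?R"
    by (auto simp: entry_event_def rising_event_eq intro!: bexI[of _ m])
next
  fix \<omega> assume "\<omega> \<in> ?R"
  then obtain m where m: "m \<le> n" "\<omega> \<in> entry_event i x m" "\<omega> \<in> rising_event M S x m n" by auto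
  have "S m \<omega> \<le> S n \<omega>"
    using m(1,3) by (induction n rule: dec_induct) (force simp: rising_event_def)+
  with m show "\<omega> \<in> ?L"
    by (auto simp: entry_event_def rising_event_eq)
qed

text \<open>The number of pieces grows with \<open>n\<close>, so limits are taken under the sum by
  Tannery's theorem, with the summable bound of \<open>summable_entry_event\<close>.\<close>

lemma excess_level_tendsto_0:
  assumes rising: "\<And>m. (\<lambda>n. excess n (rising_event M S x m n)) \<longlonglongrightarrow> 0"
  shows "(\<lambda>n. excess n {\<omega>\<in>space M. drawdowns S n \<omega> = i \<and> x \<le> S n \<omega>}) \<longlonglongrightarrow> 0"
proof -
  let ?E = "\<lambda>m n. entry_event i x m \<inter> rising_event M S x m n"
  \<comment> \<open>The value zero for \<open>m > n\<close> turns the growing finite sums into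
    series over one index set.\<close>
  let ?a = "\<lambda>m n. if m \<le> n then excess n (?E m n) else 0"
  let ?b = "\<lambda>m. \<integral>\<omega>. S m \<omega> * indicator (entry_event i x m) \<omega> \<partial>M"
  have G: "entry_event i x m \<in> sets M" for m using entry_event_sets sets_F_subset by blast
  have E: "?E m n \<in> sets M" for m n using G by auto
  have "excess n {\<omega>\<in>space M. drawdowns S n \<omega> = i \<and> x \<le> S n \<omega>} = (\<Sum>m. ?a m n)" for n
  proof -
    have "disjoint_family_on (\<lambda>m. ?E m n) {..n}"
      using disjoint_entry_event[of i x "{..n}"] by (auto simp: disjoint_family_on_def)
    then have "excess n {\<omega>\<in>space M. drawdowns S n \<omega> = i \<and> x \<le> S n \<omega>} = (\<Sum>m\<le>n. excess n (?E m n))"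
      unfolding entry_decomposition by (intro excess_UN E) auto
    also have "\<dots> = (\<Sum>m\<le>n. ?a m n)" by simp
    also have "\<dots> = (\<Sum>m. ?a m n)" by (rule suminf_finite[symmetric]) auto
    finally show ?thesis .
  qed
  moreover have "(\<lambda>n. \<Sum>m. ?a m n) \<longlonglongrightarrow> (\<Sum>m. 0)"
  proof (rule tannerys_theorem[THEN conjunct2, THEN conjunct2])
    fix m
    show "?a m \<longlonglongrightarrow> 0"
    proof (rule tendsto_sandwich[OF _ _ tendsto_const rising[of m]])
      show "\<forall>\<^sub>F n in sequentially. 0 \<le> ?a m n" by (simp add: excess_nonneg)
      show "\<forall>\<^sub>F n in sequentially. ?a m n \<le> excess n (rising_event M S x m n)"
        using E by (auto simp: excess_nonneg intro!: always_eventually excess_mono)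
    qed
  next
    have "norm (?a m n) \<le> ?b m" for m n
    proof (cases "m \<le> n")
      case True
      have "excess n (?E m n) \<le> excess n (entry_event i x m)"
        by (intro excess_mono E G) auto
      also have "\<dots> \<le> ?b m" by (rule excess_le[OF entry_event_sets True])
      finally show ?thesis using True by (simp add: excess_nonneg)
    next
      case False
      then show ?thesis
        using AE_nonneg by (auto intro!: integral_nonneg_AE elim!: eventually_mono)
    qed
    then show "\<forall>\<^sub>F (m, n) in at_top \<times>\<^sub>F sequentially. norm (?a m n) \<le> ?b m"
      by (intro always_eventually) auto
  qed (use summable_entry_event in auto)
  ultimately show ?thesis by simp
qed

text \<open>A path with fewer than \<open>k\<close> drawdowns is either below \<open>x\<close> at
  time \<open>n\<close> or in one of \<open>k\<close> level events; each of these finitely many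
  pieces has vanishing excess.\<close>

lemma excess_drawdowns_tendsto_0:
  assumes rising: "\<And>m. (\<lambda>n. excess n (rising_event M S x m n)) \<longlonglongrightarrow> 0"
  shows "(\<lambda>n. excess n {\<omega>\<in>space M. drawdowns S n \<omega> < k}) \<longlonglongrightarrow> 0"
proof -
  let ?A = "\<lambda>n. {\<omega>\<in>space M. S n \<omega> < x}"
  let ?B = "\<lambda>i n. {\<omega>\<in>space M. drawdowns S n \<omega> = i \<and> x \<le> S n \<omega>}"
  have le: "norm (excess n {\<omega>\<in>space M. drawdowns S n \<omega> < k})
      \<le> excess n (?A n) + (\<Sum>i<k. excess n (?B i n))" for n
  proof -
    have 1: "excess n (\<Union>i<k. ?B i n) = (\<Sum>i<k. excess n (?B i n))"
      by (rule excess_UN) (auto simp: disjoint_family_on_def)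
    \<comment> \<open>Indexing the two pieces by truth values makes additivity over disjoint
      families applicable; the level \<open>x\<close> separates them.\<close>
    have 2: "excess n (\<Union>b\<in>{True, False}. if b then ?A n else (\<Union>i<k. ?B i n)) =
        excess n (?A n) + excess n (\<Union>i<k. ?B i n)"
      by (subst excess_UN) (auto simp: disjoint_family_on_def)
    have "excess n {\<omega>\<in>space M. drawdowns S n \<omega> < k}
        \<le> excess n (\<Union>b\<in>{True, False}. if b then ?A n else (\<Union>i<k. ?B i n))"
      by (rule excess_mono) auto
    with 1 2 show ?thesis by (simp add: excess_nonneg)
  qed
  have "(\<lambda>n. excess n (?A n) + (\<Sum>i<k. excess n (?B i n))) \<longlonglongrightarrow> 0 + (\<Sum>i<k. 0)"
  proof (rule tendsto_add)
    show "(\<lambda>n. excess n (?A n)) \<longlonglongrightarrow> 0"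
      by (rule excess_tendsto_0_if_bounded[where x = x]) auto
    show "(\<lambda>n. \<Sum>i<k. excess n (?B i n)) \<longlonglongrightarrow> (\<Sum>i<k. 0)"
      by (rule tendsto_sum) (rule excess_level_tendsto_0[OF rising])
  qed
  then have "(\<lambda>n. excess n (?A n) + (\<Sum>i<k. excess n (?B i n))) \<longlonglongrightarrow> 0" by simp
  then show ?thesis
    by (rule Lim_null_comparison[OF always_eventually, rotated]) (intro allI le)
qed

section \<open>Bubbles and rising events\<close>

lemma bubble_if_rising:
  assumes "0 < L" "(\<lambda>n. excess n (rising_event M S x m n)) \<longlonglongrightarrow> L"
  shows "bubble M F S"
proof -
  \<comment> \<open>At most \<open>m\<close> drawdowns fit into the first \<open>m\<close> steps and
    a rising path adds none up to \<open>n\<close>, hence the bound \<open>Suc m\<close>.\<close>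
  have sub: "rising_event M S x m n \<subseteq> {\<omega>\<in>space M. drawdowns S n \<omega> < Suc m}" if "m \<le> n" for n
    using drawdowns_le[of S m] that by (auto simp: rising_event_eq less_Suc_eq_le)
  have "L \<le> (\<integral>\<omega>. S 0 \<omega> \<partial>M) - (\<integral>\<omega>. stopped_at S (drawdown_time S (Suc m)) \<omega> \<partial>M)"
    by (rule LIMSEQ_le[OF assms(2) excess_drawdowns_tendsto])
       (auto intro!: exI[of _ m] excess_mono sub)
  with assms(1) nonneg_martingale show ?thesis
    unfolding bubble_def by (intro conjI exI[of _ "Suc m"]) auto
qed

text \<open>The excess limits exist and are nonnegative; if none were positive, all would vanish and
  stopping at any drawdown would preserve the mean. The level \<open>x\<close> is arbitrary, which
  yields the form for all levels.\<close>

lemma rising_if_bubble: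
  assumes "bubble M F S"
  shows "\<exists>m. \<exists>L>0. (\<lambda>n. excess n (rising_event M S x m n)) \<longlonglongrightarrow> L"
proof (rule ccontr)
  assume no: "\<not> ?thesis"
  have "(\<lambda>n. excess n (rising_event M S x m n)) \<longlonglongrightarrow> 0" for m
  proof -
    obtain L where L: "(\<lambda>n. excess n (rising_event M S x m n)) \<longlonglongrightarrow> L"
      using excess_rising_event_convergent by (auto simp: convergent_def)
    then have "0 \<le> L" by (rule LIMSEQ_le_const) (auto simp: excess_nonneg)
    with L no show ?thesis by (metis order_le_less)
  qed
  then have "(\<lambda>n. excess n {\<omega>\<in>space M. drawdowns S n \<omega> < k}) \<longlonglongrightarrow> 0" for k
    by (rule excess_drawdowns_tendsto_0)
  from LIMSEQ_unique[OF excess_drawdowns_tendsto this] assms show False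
    by (auto simp: bubble_def)
qed

end

theorem corollary1p5:
  fixes M :: "'a measure" and F :: "nat \<Rightarrow> 'a measure" and S :: "nat \<Rightarrow> 'a \<Rightarrow> real"
  assumes "nonneg_martingale M F S"
  shows "(bubble M F S \<longleftrightarrow>
           (\<exists>x\<ge>0. \<exists>k. \<exists>L>0.
             (\<lambda>n. \<integral>\<omega>. (S n \<omega> - limit_value S \<omega>) * indicator (rising_event M S x k n) \<omega> \<partial>M)
               \<longlonglongrightarrow> L)) \<and>
         (bubble M F S \<longleftrightarrow>
           (\<forall>x\<ge>0. \<exists>k. \<exists>L>0.
             (\<lambda>n. \<integral>\<omega>. (S n \<omega> - limit_value S \<omega>) * indicator (rising_event M S x k n) \<omega> \<partial>M)
               \<longlonglongrightarrow> L))"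
proof -
  interpret nonneg_martingale_process M F S by unfold_locales (rule assms)
  \<comment> \<open>Level \<open>0\<close> is the witness for the existential form and the instance
    taken from the universal one.\<close>
  show ?thesis
    unfolding loss_tendsto_iff_excess[OF rising_event_measurable]
    using bubble_if_rising rising_if_bubble by (meson order_refl)
qed

end
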